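(* Let $\kappa\ge\omega_1$ be a cardinal. If there are cardinals $\mu$ and $\theta$ such that $\mu^{<\theta}=\mu<\kappa\le\mu^\theta$, then $\kappa$ is not $\kappa$-square compact.
   Context: A topological space $X$ is $\kappa$-compact if every open cover of $X$ has a subcover of size less than $\kappa$. The weight of a space is the least cardinality of a base for its topology. An infinite cardinal $\kappa$ is $\kappa$-square compact if for every topological space $X$ of weight $\le\kappa$, if $X$ is $\kappa$-compact then $X^2$ (with the product topology) is $\kappa$-compact. *)

theory Defs
  imports "HOL-Analysis.Analysis"
begin

unbundle cardinal_syntax
no_notation elt_set_eq (infix \<open>=o\<close> 50)

text \<open>Cardinals are relations \<open>r\<close> with \<open>Card_order r\<close>, compared by \<open>\<le>o\<close>, \<open><o\<close> and \<open>=o\<close>.\<close>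

definition topology_base :: "'a topology \<Rightarrow> 'a set set \<Rightarrow> bool" where
  "topology_base X \<B> \<longleftrightarrow> (\<forall>V\<in>\<B>. openin X V) \<and>
     (\<forall>U x. openin X U \<and> x \<in> U \<longrightarrow> (\<exists>V\<in>\<B>. x \<in> V \<and> V \<subseteq> U))"

definition weight :: "'a topology \<Rightarrow> 'a set rel" where
  "weight X = |SOME \<B>. topology_base X \<B> \<and> (\<forall>\<B>'. topology_base X \<B>' \<longrightarrow> |\<B>| \<le>o |\<B>'| )|"

definition kappa_compact :: "'k rel \<Rightarrow> 'a topology \<Rightarrow> bool" where
  "kappa_compact \<kappa> X \<longleftrightarrow>
     (\<forall>\<U>. (\<forall>U\<in>\<U>. openin X U) \<and> \<Union>\<U> = topspace X \<longrightarrow>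
        (\<exists>\<V>\<subseteq>\<U>. |\<V>| <o \<kappa> \<and> \<Union>\<V> = topspace X))"

text \<open>The points of \<open>X\<close> are taken from the power set type \<open>'k set\<close>. Nothing is lost: the
  Kolmogorov quotient of a space of weight at most \<open>\<kappa>\<close> has at most \<open>2\<^sup>\<kappa>\<close> points, and
  \<open>square_compact_any_type\<close> below derives the property for spaces over an arbitrary type.\<close>

definition square_compact :: "'k rel \<Rightarrow> bool" where
  "square_compact \<kappa> \<longleftrightarrow>
     (\<forall>X :: 'k set topology. weight X \<le>o \<kappa> \<and> kappa_compact \<kappa> X \<longrightarrow>
        kappa_compact \<kappa> (prod_topology X X))"

text \<open>\<open>cexp_less \<mu> \<theta>\<close> is \<open>\<mu>\<close> to the power \<open><\<theta>\<close>, the supremum of the cardinals \<open>\<mu> ^c \<nu>\<close> over all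
  cardinals \<open>\<nu> <o \<theta>\<close>. Every such \<open>\<nu>\<close> is represented on the type of \<open>\<theta>\<close>, and
  the supremum on the type of the powers; the choice is unique up to \<open>=o\<close>.\<close>

definition cexp_less_bound :: "'m rel \<Rightarrow> 't rel \<Rightarrow> 's rel \<Rightarrow> bool" where
  "cexp_less_bound \<mu> \<theta> r \<longleftrightarrow>
     Card_order r \<and> (\<forall>\<nu> :: 't rel. Card_order \<nu> \<and> \<nu> <o \<theta> \<longrightarrow> \<mu> ^c \<nu> \<le>o r)"

definition cexp_less :: "'m rel \<Rightarrow> 't rel \<Rightarrow> ('t \<Rightarrow> 'm) rel" where
  "cexp_less \<mu> \<theta> =
     (SOME r. cexp_less_bound \<mu> \<theta> r \<and>
        (\<forall>r' :: ('t \<Rightarrow> 'm) rel. cexp_less_bound \<mu> \<theta> r' \<longrightarrow> r \<le>o r'))"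

lemma weight_attained:
  obtains \<B> where "topology_base X \<B>" "weight X = |\<B>|"
    "\<And>\<B>'. topology_base X \<B>' \<Longrightarrow> |\<B>| \<le>o |\<B>'|"
proof -
  have "topology_base X {U. openin X U}"
    by (auto simp: topology_base_def)
  then have "\<exists>r\<in>{|\<B>| |\<B>. topology_base X \<B>}. \<forall>r'\<in>{|\<B>| |\<B>. topology_base X \<B>}. r \<le>o r'"
    by (intro exists_minim_Card_order) (auto simp: card_of_Card_order)
  then have "\<exists>\<B>. topology_base X \<B> \<and> (\<forall>\<B>'. topology_base X \<B>' \<longrightarrow> |\<B>| \<le>o |\<B>'| )"
    by blast
  from someI_ex[OF this] that show thesis
    unfolding weight_def by blast
qed

lemma weight_ordLeq_iff:
  "weight X \<le>o r \<longleftrightarrow> (\<exists>\<B>. topology_base X \<B> \<and> |\<B>| \<le>o r)"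
proof (rule weight_attained[of X])
  fix \<B> assume \<B>: "topology_base X \<B>" "weight X = |\<B>|"
    "\<And>\<B>'. topology_base X \<B>' \<Longrightarrow> |\<B>| \<le>o |\<B>'|"
  then show ?thesis
    using ordLeq_transitive[OF \<B>(3)] by auto
qed

lemma cexp_less_is_least_bound:
  fixes \<mu> :: "'m rel" and \<theta> :: "'t rel" and s :: "'s rel"
  shows "cexp_less_bound \<mu> \<theta> (cexp_less \<mu> \<theta>)" (is ?A)
  "cexp_less_bound \<mu> \<theta> s \<Longrightarrow> cexp_less \<mu> \<theta> \<le>o s"
proof -
  let ?R = "{r. cexp_less_bound \<mu> \<theta> (r :: ('t \<Rightarrow> 'm) rel)}"
  have "cexp_less_bound \<mu> \<theta> |UNIV :: ('t \<Rightarrow> 'm) set|"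
    by (simp add: cexp_less_bound_def cexp_def card_of_Card_order card_of_mono1)
  then have "\<exists>r\<in>?R. \<forall>r'\<in>?R. r \<le>o r'"
    by (intro exists_minim_Card_order) (auto simp: cexp_less_bound_def)
  then have "\<exists>r :: ('t \<Rightarrow> 'm) rel. cexp_less_bound \<mu> \<theta> r \<and>
      (\<forall>r' :: ('t \<Rightarrow> 'm) rel. cexp_less_bound \<mu> \<theta> r' \<longrightarrow> r \<le>o r')"
    by blast
  from someI_ex[OF this]
  have A: ?A and least: "\<And>r' :: ('t \<Rightarrow> 'm) rel. cexp_less_bound \<mu> \<theta> r' \<Longrightarrow> cexp_less \<mu> \<theta> \<le>o r'"
    unfolding cexp_less_def by blast+
  show ?A by (rule A)
  assume s: "cexp_less_bound \<mu> \<theta> s"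
  show "cexp_less \<mu> \<theta> \<le>o s"
  proof (rule ccontr)
    assume "\<not> cexp_less \<mu> \<theta> \<le>o s"
    moreover have "Well_order s" "Well_order (cexp_less \<mu> \<theta>)"
      using s A by (auto simp: cexp_less_bound_def card_order_on_well_order_on)
    ultimately have less: "s <o cexp_less \<mu> \<theta>"
      using not_ordLeq_iff_ordLess by blast
    have "|Field s| =o s"
      using s by (simp add: cexp_less_bound_def card_of_Field_ordIso)
    moreover from this have "|Field s| \<le>o cexp_less \<mu> \<theta>"
      using less by (meson ordIso_ordLess_trans ordLess_imp_ordLeq)
    ultimately obtain B where B: "B \<subseteq> Field (cexp_less \<mu> \<theta>)" "s =o |B|"
      by (metis internalize_card_of_ordLeq ordIso_symmetric ordIso_transitive)
    have "cexp_less_bound \<mu> \<theta> |B|"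
      using s B(2) unfolding cexp_less_bound_def by (meson card_of_Card_order ordLeq_ordIso_trans)
    then have "cexp_less \<mu> \<theta> \<le>o s"
      using ordLeq_ordIso_trans[OF least ordIso_symmetric[OF B(2)]] by blast
    then show False
      using less not_ordLess_ordLeq by blast
  qed
qed

lemma square_compact_any_type:
  fixes X :: "'a topology" and \<kappa> :: "'k rel"
  assumes sq: "square_compact \<kappa>" and w: "weight X \<le>o \<kappa>" and X: "kappa_compact \<kappa> X"
  shows "kappa_compact \<kappa> (prod_topology X X)"
proof -
  obtain \<B> where \<B>: "topology_base X \<B>" "|\<B>| \<le>o \<kappa>"
    using w by (auto simp: weight_ordLeq_iff)
  obtain C where C: "C \<subseteq> Field \<kappa>" "|\<B>| =o |C|"
    using iffD1[OF internalize_card_of_ordLeq \<B>(2)] by auto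
  obtain e where "bij_betw e \<B> C"
    using iffD2[OF card_of_ordIso C(2)] by auto
  then have e: "inj_on e \<B>"
    by (rule bij_betw_imp_inj_on)
  define f where "f x = e ` {b\<in>\<B>. x \<in> b}" for x
  have f_eq: "b \<in> \<B> \<Longrightarrow> f x = f y \<Longrightarrow> x \<in> b \<Longrightarrow> y \<in> b" for x y b
    using e unfolding f_def inj_on_def by blast
  have sat: "y \<in> U" if "openin X U" "x \<in> U" "f x = f y" for U x y
    using that \<B>(1) f_eq unfolding topology_base_def by (meson subsetD)
  have Int: "f ` U \<inter> f ` V = f ` (U \<inter> V)" if "openin X U" "openin X V" for U V
    using sat that by (fastforce simp: image_iff)
  define P where "P W \<longleftrightarrow> (\<exists>U. openin X U \<and> W = f ` U)" for W
  have "istopology P"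
    unfolding istopology_def
  proof (intro conjI allI impI)
    fix S T assume "P S" "P T"
    then show "P (S \<inter> T)"
      unfolding P_def using Int by (metis openin_Int)
  next
    fix \<K> assume "\<forall>K\<in>\<K>. P K"
    then obtain g where g: "\<And>K. K \<in> \<K> \<Longrightarrow> openin X (g K) \<and> K = f ` g K"
      unfolding P_def by metis
    then have "\<Union>\<K> = f ` \<Union>(g ` \<K>)" by blast
    moreover have "openin X (\<Union>(g ` \<K>))" using g by blast
    ultimately show "P (\<Union>\<K>)" unfolding P_def by blast
  qed
  then have Y: "openin (topology P) = P" by (rule topology_inverse')
  let ?Y = "topology P"
  have top: "topspace ?Y = f ` topspace X"
  proof
    have "P (topspace ?Y)"
      using openin_topspace[of ?Y] by (simp only: Y)
    then obtain U where "openin X U" "topspace ?Y = f ` U"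
      unfolding P_def by auto
    then show "topspace ?Y \<subseteq> f ` topspace X"
      using openin_subset[of X U] by auto
    have "P (f ` topspace X)"
      unfolding P_def by auto
    then show "f ` topspace X \<subseteq> topspace ?Y"
      by (intro openin_subset) (simp only: Y)
  qed
  have "topology_base ?Y ((`) f ` \<B>)"
    unfolding topology_base_def Y
  proof (intro conjI ballI allI impI)
    fix V assume "V \<in> (`) f ` \<B>"
    then show "P V" using \<B>(1) unfolding P_def topology_base_def by blast
  next
    fix W y assume "P W \<and> y \<in> W"
    then obtain U x where U: "openin X U" "W = f ` U" "x \<in> U" "y = f x"
      unfolding P_def by blast
    then obtain V where "V \<in> \<B>" "x \<in> V" "V \<subseteq> U"
      using \<B>(1) unfolding topology_base_def by meson
    then show "\<exists>V\<in>(`) f ` \<B>. y \<in> V \<and> V \<subseteq> W" using U by blast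
  qed
  then have wY: "weight ?Y \<le>o \<kappa>"
    using ordLeq_transitive[OF card_of_image \<B>(2)] unfolding weight_ordLeq_iff by blast
  have "kappa_compact \<kappa> ?Y"
    unfolding kappa_compact_def
  proof (intro allI impI)
    fix \<U> assume \<U>: "(\<forall>U\<in>\<U>. openin ?Y U) \<and> \<Union>\<U> = topspace ?Y"
    then obtain g where g: "\<And>K. K \<in> \<U> \<Longrightarrow> openin X (g K) \<and> K = f ` g K"
      unfolding Y P_def by metis
    have "\<Union>(g ` \<U>) = topspace X"
    proof
      show "\<Union>(g ` \<U>) \<subseteq> topspace X" using g openin_subset by blast
      show "topspace X \<subseteq> \<Union>(g ` \<U>)"
      proof
        fix x assume "x \<in> topspace X"
        then have "f x \<in> topspace ?Y" unfolding top by (rule imageI)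
        then have "f x \<in> \<Union>\<U>" using conjunct2[OF \<U>] by simp
        then obtain K where K: "K \<in> \<U>" "f x \<in> K" by (rule UnionE)
        have gK: "openin X (g K)" "K = f ` g K" using g[OF K(1)] by simp_all
        have "f x \<in> f ` g K" using K(2) gK(2) by simp
        then obtain z where "z \<in> g K" "f z = f x" by (metis imageE)
        then have "x \<in> g K" using sat[OF gK(1)] by metis
        then show "x \<in> \<Union>(g ` \<U>)" using K(1) by (rule UN_I[rotated])
      qed
    qed
    moreover have "\<forall>U\<in>g ` \<U>. openin X U"
      using g by simp
    ultimately obtain \<V> where \<V>: "\<V> \<subseteq> g ` \<U>" "|\<V>| <o \<kappa>" "\<Union>\<V> = topspace X"
      using X unfolding kappa_compact_def by meson
    have "(`) f ` \<V> \<subseteq> \<U>"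
    proof (rule image_subsetI)
      fix V assume "V \<in> \<V>"
      with \<V>(1) obtain K where "K \<in> \<U>" "V = g K" by auto
      with g[of K] show "f ` V \<in> \<U>" by simp
    qed
    moreover have "|(`) f ` \<V>| <o \<kappa>"
      by (rule ordLeq_ordLess_trans[OF card_of_image \<V>(2)])
    moreover have "\<Union>((`) f ` \<V>) = topspace ?Y"
      unfolding top \<V>(3)[symmetric] by auto
    ultimately show "\<exists>\<V>\<subseteq>\<U>. |\<V>| <o \<kappa> \<and> \<Union>\<V> = topspace ?Y" by blast
  qed
  then have YY: "kappa_compact \<kappa> (prod_topology ?Y ?Y)"
    using sq wY unfolding square_compact_def by blast
  let ?h = "map_prod f f"
  have sat2: "q \<in> U" if U: "openin (prod_topology X X) U" "p \<in> U" "?h p = ?h q" for U p q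
  proof -
    obtain a b c d where pq: "p = (a, b)" "q = (c, d)" by (metis surj_pair)
    then obtain V W where "openin X V" "openin X W" "a \<in> V" "b \<in> W" "V \<times> W \<subseteq> U"
      using U by (metis openin_prod_topology_alt)
    then show ?thesis using sat U(3) pq by auto
  qed
  have open2: "openin (prod_topology ?Y ?Y) (?h ` U)" if U: "openin (prod_topology X X) U" for U
    unfolding openin_prod_topology_alt
  proof (intro allI impI)
    fix x y assume "(x, y) \<in> ?h ` U"
    then obtain a b where ab: "(a, b) \<in> U" "x = f a" "y = f b" by auto
    then obtain V W where VW: "openin X V" "openin X W" "a \<in> V" "b \<in> W" "V \<times> W \<subseteq> U"
      using U by (metis openin_prod_topology_alt)
    then have "f ` V \<times> f ` W \<subseteq> ?h ` U" by auto
    then show "\<exists>U' V'. openin ?Y U' \<and> openin ?Y V' \<and> x \<in> U' \<and> y \<in> V' \<and> U' \<times> V' \<subseteq> ?h ` U"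
      unfolding Y P_def using VW ab by blast
  qed
  show ?thesis
    unfolding kappa_compact_def
  proof (intro allI impI)
    fix \<U> assume \<U>: "(\<forall>U\<in>\<U>. openin (prod_topology X X) U) \<and> \<Union>\<U> = topspace (prod_topology X X)"
    have "\<Union>((`) ?h ` \<U>) = ?h ` \<Union>\<U>" by blast
    also have "\<dots> = topspace (prod_topology ?Y ?Y)"
      using \<U> top by (simp add: map_prod_surj_on)
    finally have "\<Union>((`) ?h ` \<U>) = topspace (prod_topology ?Y ?Y)" .
    moreover have "\<forall>V\<in>(`) ?h ` \<U>. openin (prod_topology ?Y ?Y) V"
      using \<U> open2 by blast
    ultimately obtain \<V> where \<V>: "\<V> \<subseteq> (`) ?h ` \<U>" "|\<V>| <o \<kappa>"
        "\<Union>\<V> = topspace (prod_topology ?Y ?Y)"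
      using YY unfolding kappa_compact_def by meson
    have "\<forall>V\<in>\<V>. \<exists>U. U \<in> \<U> \<and> V = ?h ` U"
      using \<V>(1) by auto
    from bchoice[OF this] obtain g where g: "\<And>V. V \<in> \<V> \<Longrightarrow> g V \<in> \<U> \<and> V = ?h ` g V"
      by auto
    have "g ` \<V> \<subseteq> \<U>" using g by (intro image_subsetI) simp
    moreover have "|g ` \<V>| <o \<kappa>"
      by (rule ordLeq_ordLess_trans[OF card_of_image \<V>(2)])
    moreover have "\<Union>(g ` \<V>) = topspace (prod_topology X X)"
    proof
      show "\<Union>(g ` \<V>) \<subseteq> topspace (prod_topology X X)"
        unfolding conjunct2[OF \<U>, symmetric]
        by (rule Union_mono) (use g in \<open>intro image_subsetI, simp\<close>)
      show "topspace (prod_topology X X) \<subseteq> \<Union>(g ` \<V>)"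
      proof
        fix q assume "q \<in> topspace (prod_topology X X)"
        then have "?h q \<in> \<Union>\<V>" unfolding \<V>(3) by (auto simp: top)
        then obtain V where V: "V \<in> \<V>" "?h q \<in> V" by (rule UnionE)
        have gV: "g V \<in> \<U>" "V = ?h ` g V" using g[OF V(1)] by simp_all
        have "?h q \<in> ?h ` g V" using V(2) gV(2) by simp
        then obtain p where p: "p \<in> g V" "?h p = ?h q" by (metis imageE)
        have "openin (prod_topology X X) (g V)" using \<U> gV(1) by simp
        then have "q \<in> g V" using sat2 p by metis
        then show "q \<in> \<Union>(g ` \<V>)" using V(1) by (rule UN_I[rotated])
      qed
    qed
    ultimately show "\<exists>\<V>\<subseteq>\<U>. |\<V>| <o \<kappa> \<and> \<Union>\<V> = topspace (prod_topology X X)" by blast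
  qed
qed

end

theory Submission
  imports Defs
begin

text \<open>Order \<open>\<mu>\<^sup>\<theta>\<close> lexicographically, and let \<open>S\<close> be a subset of size \<open>\<kappa>\<close>. There are only
  \<open>\<mu>\<^sup>{<\<theta>} = \<mu>\<close> many cones (sets of functions with a prescribed initial segment). They form a base of
  a topology on \<open>S\<close> in which the open rays of the order are open, and so play the role of the
  rational intervals: the argument for the Sorgenfrey line shows that every cover of \<open>S\<close> by sets
  open in the topology generated by the right halves of cones has a subcover of size at most \<open>\<mu>\<close>,
  and likewise for left halves. The disjoint sum of these two Sorgenfrey topologies is thus
  \<open>\<kappa>\<close>-compact, but its square contains the diagonal of \<open>S\<close>, taken between the two summands, as a
  closed discrete set of size \<open>\<kappa>\<close>.\<close>

subsection \<open>Weight and \<open>\<kappa>\<close>-compactness\<close>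

lemma istopology_filtered_nhds:
  assumes "\<And>x M N. M \<in> \<N> x \<Longrightarrow> N \<in> \<N> x \<Longrightarrow> \<exists>L\<in>\<N> x. L \<subseteq> M \<inter> N"
  shows "istopology (\<lambda>U. U \<subseteq> S \<and> (\<forall>x\<in>U. \<exists>N\<in>\<N> x. N \<subseteq> U))"
  unfolding istopology_def
proof (rule conjI; intro allI impI conjI ballI)
  fix U V x
  assume U: "U \<subseteq> S \<and> (\<forall>x\<in>U. \<exists>N\<in>\<N> x. N \<subseteq> U)"
    and V: "V \<subseteq> S \<and> (\<forall>x\<in>V. \<exists>N\<in>\<N> x. N \<subseteq> V)"
    and x: "x \<in> U \<inter> V"
  obtain M N where MN: "M \<in> \<N> x" "M \<subseteq> U" "N \<in> \<N> x" "N \<subseteq> V"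
    using U V x by (meson IntD1 IntD2)
  obtain L where "L \<in> \<N> x" "L \<subseteq> M \<inter> N"
    using assms[OF MN(1,3)] by (rule bexE)
  then show "\<exists>L\<in>\<N> x. L \<subseteq> U \<inter> V"
    using MN(2,4) by (intro bexI[of _ L]) auto
next
  fix \<K> x
  assume \<K>: "\<forall>K\<in>\<K>. K \<subseteq> S \<and> (\<forall>x\<in>K. \<exists>N\<in>\<N> x. N \<subseteq> K)" and "x \<in> \<Union>\<K>"
  then obtain K where "K \<in> \<K>" "x \<in> K"
    by blast
  then obtain N where "N \<in> \<N> x" "N \<subseteq> K"
    using \<K> by meson
  then show "\<exists>N\<in>\<N> x. N \<subseteq> \<Union>\<K>"
    using \<open>K \<in> \<K>\<close> by (intro bexI[of _ N]) auto
qed blast+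

lemma topology_base_openinE:
  assumes "topology_base X \<B>" "openin X U" "x \<in> U"
  obtains V where "V \<in> \<B>" "x \<in> V" "V \<subseteq> U"
  using assms unfolding topology_base_def by meson

lemma open_family_subfamily_ordLeq_weight:
  assumes "weight X \<le>o \<mu>" and W: "\<And>i. i \<in> I \<Longrightarrow> openin X (W i)"
  obtains J where "J \<subseteq> I" "|J| \<le>o \<mu>" "(\<Union>i\<in>J. W i) = (\<Union>i\<in>I. W i)"
proof -
  obtain \<B> where \<B>: "topology_base X \<B>" "|\<B>| \<le>o \<mu>"
    using assms(1) by (auto simp: weight_ordLeq_iff)
  define \<C> where "\<C> = {B \<in> \<B>. \<exists>i\<in>I. B \<subseteq> W i}"
  have "\<forall>B\<in>\<C>. \<exists>i\<in>I. B \<subseteq> W i"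
    by (simp add: \<C>_def)
  then obtain f where f: "\<And>B. B \<in> \<C> \<Longrightarrow> f B \<in> I" "\<And>B. B \<in> \<C> \<Longrightarrow> B \<subseteq> W (f B)"
    by metis
  have "|\<C>| \<le>o \<mu>"
    by (rule ordLeq_transitive[OF card_of_mono1 \<B>(2)]) (auto simp: \<C>_def)
  then have "|f ` \<C>| \<le>o \<mu>"
    by (rule ordLeq_transitive[OF card_of_image])
  moreover have "f ` \<C> \<subseteq> I"
    using f by blast
  moreover have "x \<in> (\<Union>i\<in>f ` \<C>. W i)" if "i \<in> I" "x \<in> W i" for i x
  proof -
    obtain B where B: "B \<in> \<B>" "x \<in> B" "B \<subseteq> W i"
      by (rule topology_base_openinE[OF \<B>(1) W[OF \<open>i \<in> I\<close>] \<open>x \<in> W i\<close>])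
    then have "B \<in> \<C>"
      using \<open>i \<in> I\<close> by (auto simp: \<C>_def)
    then show ?thesis
      using f B(2) by blast
  qed
  then have "(\<Union>i\<in>f ` \<C>. W i) = (\<Union>i\<in>I. W i)"
    using \<open>f ` \<C> \<subseteq> I\<close> by blast
  ultimately show thesis
    using that by blast
qed

lemma openin_sum_topology_summand:
  assumes "i \<in> I" "openin (X i) U"
  shows "openin (sum_topology X I) ({i} \<times> U)"
proof -
  have "{i} \<times> U = Pair i ` U"
    by blast
  then show ?thesis
    using open_map_component_injection[of i I X] assms by (simp add: open_map_def)
qed

lemma closedin_sum_topology_summand:
  assumes "i \<in> I" "closedin (X i) C"
  shows "closedin (sum_topology X I) ({i} \<times> C)"
proof -
  have "{i} \<times> C = Pair i ` C"
    by blast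
  then show ?thesis
    using closed_map_component_injection[of i I X] assms by (simp add: closed_map_def)
qed

lemma weight_sum_topology:
  assumes "|I| \<le>o \<kappa>" "Cinfinite \<kappa>" and X: "\<And>i. i \<in> I \<Longrightarrow> weight (X i) \<le>o \<kappa>"
  shows "weight (sum_topology X I) \<le>o \<kappa>"
proof -
  have "\<forall>i\<in>I. \<exists>\<B>. topology_base (X i) \<B> \<and> |\<B>| \<le>o \<kappa>"
    using X by (simp add: weight_ordLeq_iff)
  from bchoice[OF this] obtain \<B>
    where \<B>: "\<And>i. i \<in> I \<Longrightarrow> topology_base (X i) (\<B> i)" "\<And>i. i \<in> I \<Longrightarrow> |\<B> i| \<le>o \<kappa>"
    by blast
  let ?\<B> = "\<Union>i\<in>I. (\<times>) {i} ` \<B> i"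
  have "topology_base (sum_topology X I) ?\<B>"
    unfolding topology_base_def
  proof (intro conjI ballI allI impI)
    fix V assume "V \<in> ?\<B>"
    then show "openin (sum_topology X I) V"
      using \<B>(1) openin_sum_topology_summand[of _ I X] by (auto simp: topology_base_def)
  next
    fix U p assume U: "openin (sum_topology X I) U \<and> p \<in> U"
    then obtain i x where p: "p = (i, x)" "i \<in> I"
      by (auto simp: openin_sum_topology)
    then have "openin (X i) {x. (i, x) \<in> U}"
      using U by (simp add: openin_sum_topology)
    then obtain V where "V \<in> \<B> i" "x \<in> V" "V \<subseteq> {x. (i, x) \<in> U}"
      using topology_base_openinE[OF \<B>(1)[OF p(2)]] U p(1) by blast
    then show "\<exists>V\<in>?\<B>. p \<in> V \<and> V \<subseteq> U"
      using p by (intro bexI[of _ "{i} \<times> V"]) auto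
  qed
  moreover have "|?\<B>| \<le>o \<kappa>"
    using assms(1,2) \<B>(2) ordLeq_transitive[OF card_of_image]
    by (intro UNION_Cinfinite_bound) blast+
  ultimately show ?thesis
    unfolding weight_ordLeq_iff by blast
qed

lemma kappa_compactI:
  assumes "\<And>\<U>. (\<And>U. U \<in> \<U> \<Longrightarrow> openin X U) \<Longrightarrow> topspace X \<subseteq> \<Union>\<U> \<Longrightarrow>
      \<exists>\<V>\<subseteq>\<U>. |\<V>| <o \<kappa> \<and> topspace X \<subseteq> \<Union>\<V>"
  shows "kappa_compact \<kappa> X"
  unfolding kappa_compact_def
proof (intro allI impI)
  fix \<U> assume \<U>: "(\<forall>U\<in>\<U>. openin X U) \<and> \<Union>\<U> = topspace X"
  have "\<exists>\<V>\<subseteq>\<U>. |\<V>| <o \<kappa> \<and> topspace X \<subseteq> \<Union>\<V>"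
    by (rule assms) (use \<U> in simp_all)
  then show "\<exists>\<V>\<subseteq>\<U>. |\<V>| <o \<kappa> \<and> \<Union>\<V> = topspace X"
    using \<U> by (metis Union_mono subset_antisym)
qed

lemma kappa_compactE:
  assumes "kappa_compact \<kappa> X" "\<And>U. U \<in> \<U> \<Longrightarrow> openin X U" "topspace X \<subseteq> \<Union>\<U>"
  obtains \<V> where "\<V> \<subseteq> \<U>" "|\<V>| <o \<kappa>" "\<Union>\<V> = topspace X"
proof -
  have "\<Union>\<U> = topspace X"
    using assms(2,3) openin_subset by blast
  then show thesis
    using assms(1,2) that unfolding kappa_compact_def by meson
qed

lemma kappa_compact_mono:
  assumes "kappa_compact \<kappa> X" "\<kappa> \<le>o \<kappa>'"
  shows "kappa_compact \<kappa>' X"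
  using assms ordLess_ordLeq_trans unfolding kappa_compact_def by meson

lemma kappa_compact_sum_topology:
  assumes \<kappa>: "regularCard \<kappa>" "Cinfinite \<kappa>" and I: "|I| <o \<kappa>"
    and X: "\<And>i. i \<in> I \<Longrightarrow> kappa_compact \<kappa> (X i)"
  shows "kappa_compact \<kappa> (sum_topology X I)"
proof (rule kappa_compactI)
  fix \<U> assume \<U>: "\<And>U. U \<in> \<U> \<Longrightarrow> openin (sum_topology X I) U" "topspace (sum_topology X I) \<subseteq> \<Union>\<U>"
  have "\<exists>\<V>\<subseteq>\<U>. |\<V>| <o \<kappa> \<and> {i} \<times> topspace (X i) \<subseteq> \<Union>\<V>" if "i \<in> I" for i
  proof -
    let ?slice = "\<lambda>U. {x. (i, x) \<in> U}"
    have "openin (X i) U" if "U \<in> ?slice ` \<U>" for U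
      using that \<U>(1) \<open>i \<in> I\<close> by (auto simp: openin_sum_topology)
    moreover have "topspace (X i) \<subseteq> \<Union>(?slice ` \<U>)"
      using subsetD[OF \<U>(2), of "(i, _)"] \<open>i \<in> I\<close> by auto
    ultimately obtain \<W> where \<W>: "\<W> \<subseteq> ?slice ` \<U>" "|\<W>| <o \<kappa>" "\<Union>\<W> = topspace (X i)"
      using kappa_compactE[OF X[OF \<open>i \<in> I\<close>]] by metis
    obtain \<V> where \<V>: "\<V> \<subseteq> \<U>" "\<W> = ?slice ` \<V>" "inj_on ?slice \<V>"
      using iffD1[OF subset_image_inj \<W>(1)] by metis
    have "|\<V>| =o |\<W>|"
      using \<V>(2,3) by (intro card_of_ordIsoI[of ?slice]) (simp add: bij_betw_def)
    then have "|\<V>| <o \<kappa>"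
      using \<W>(2) by (rule ordIso_ordLess_trans)
    moreover have "{i} \<times> topspace (X i) \<subseteq> \<Union>\<V>"
      unfolding \<W>(3)[symmetric] \<V>(2) by blast
    ultimately show ?thesis
      using \<V>(1) by blast
  qed
  then obtain \<V> where \<V>: "\<And>i. i \<in> I \<Longrightarrow> \<V> i \<subseteq> \<U>" "\<And>i. i \<in> I \<Longrightarrow> |\<V> i| <o \<kappa>"
      "\<And>i. i \<in> I \<Longrightarrow> {i} \<times> topspace (X i) \<subseteq> \<Union>(\<V> i)"
    by metis
  have "|\<Union>i\<in>I. \<V> i| <o \<kappa>"
    using \<kappa> I \<V>(2) by (intro card_of_UNION_ordLess_infinite_Field_regularCard) auto
  moreover have "topspace (sum_topology X I) \<subseteq> \<Union>(\<Union>i\<in>I. \<V> i)"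
    using \<V>(3) by fastforce
  ultimately show "\<exists>\<V>\<subseteq>\<U>. |\<V>| <o \<kappa> \<and> topspace (sum_topology X I) \<subseteq> \<Union>\<V>"
    using \<V>(1) by (meson UN_least)
qed

lemma kappa_compact_closedin_subtopology:
  assumes X: "kappa_compact \<kappa> X" and C: "closedin X C"
  shows "kappa_compact \<kappa> (subtopology X C)"
proof (rule kappa_compactI)
  fix \<U> assume \<U>: "\<And>U. U \<in> \<U> \<Longrightarrow> openin (subtopology X C) U" "topspace (subtopology X C) \<subseteq> \<Union>\<U>"
  have top: "topspace (subtopology X C) = C"
    using closedin_subset[OF C] by auto
  let ?\<W> = "{W. openin X W \<and> (W \<inter> C \<in> \<U> \<or> W \<inter> C = {})}"
  have "openin X W" if "W \<in> ?\<W>" for W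
    using that by simp
  moreover have "topspace X \<subseteq> \<Union>?\<W>"
  proof
    fix x assume x: "x \<in> topspace X"
    show "x \<in> \<Union>?\<W>"
    proof (cases "x \<in> C")
      case True
      then obtain U where U: "U \<in> \<U>" "x \<in> U"
        using \<U>(2) unfolding top by blast
      obtain W where "openin X W" "U = W \<inter> C"
        using \<U>(1)[OF U(1)] unfolding openin_subtopology by blast
      then show ?thesis
        using U by (intro UnionI[of W]) simp_all
    next
      case False
      then show ?thesis
        using x C by (intro UnionI[of "topspace X - C"]) (auto simp: closedin_def)
    qed
  qed
  ultimately obtain \<V> where \<V>: "\<V> \<subseteq> ?\<W>" "|\<V>| <o \<kappa>" "\<Union>\<V> = topspace X"
    by (rule kappa_compactE[OF X])
  let ?\<V> = "(\<lambda>V. V \<inter> C) ` \<V> \<inter> \<U>"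
  have "|?\<V>| \<le>o |\<V>|"
    by (rule ordLeq_transitive[OF card_of_mono1[OF Int_lower1] card_of_image])
  then have "|?\<V>| <o \<kappa>"
    using \<V>(2) by (rule ordLeq_ordLess_trans)
  moreover have "C \<subseteq> \<Union>?\<V>"
  proof
    fix x assume "x \<in> C"
    moreover from this obtain V where "V \<in> \<V>" "x \<in> V"
      using \<V>(3) closedin_subset[OF C] by (metis UnionE subsetD)
    ultimately show "x \<in> \<Union>?\<V>"
      using \<V>(1) by blast
  qed
  ultimately show "\<exists>\<V>\<subseteq>\<U>. |\<V>| <o \<kappa> \<and> topspace (subtopology X C) \<subseteq> \<Union>\<V>"
    unfolding top by (intro exI[of _ ?\<V>]) simp
qed

lemma kappa_compact_discrete_topologyD:
  assumes "kappa_compact \<kappa> (discrete_topology D)"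
  shows "|D| <o \<kappa>"
proof -
  let ?sing = "\<lambda>x. {x}"
  obtain \<V> where \<V>: "\<V> \<subseteq> ?sing ` D" "|\<V>| <o \<kappa>" "\<Union>\<V> = D"
    using kappa_compactE[OF assms, of "?sing ` D"] by auto
  then have "?sing ` D \<subseteq> \<V>"
    by blast
  then have "|D| \<le>o |\<V>|"
    by (intro card_of_ordLeqI[of ?sing]) auto
  then show ?thesis
    using \<V>(2) ordLeq_ordLess_trans by blast
qed

corollary kappa_compact_closed_discrete_ordLess:
  assumes "kappa_compact \<kappa> X" "closedin X D" "subtopology X D = discrete_topology D"
  shows "|D| <o \<kappa>"
  using assms kappa_compact_closedin_subtopology kappa_compact_discrete_topologyD by metis

subsection \<open>The Sorgenfrey refinement of a topology\<close>

definition sorgenfrey_topology :: "'a topology \<Rightarrow> 'a rel \<Rightarrow> 'a topology" where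
  "sorgenfrey_topology X r = topology (\<lambda>U. U \<subseteq> topspace X \<and>
     (\<forall>x\<in>U. \<exists>T. openin X T \<and> x \<in> T \<and> T \<inter> above r x \<subseteq> U))"

lemma openin_sorgenfrey_topology:
  "openin (sorgenfrey_topology X r) U \<longleftrightarrow>
     U \<subseteq> topspace X \<and> (\<forall>x\<in>U. \<exists>T. openin X T \<and> x \<in> T \<and> T \<inter> above r x \<subseteq> U)"
proof -
  let ?\<N> = "\<lambda>x. (\<lambda>T. T \<inter> above r x) ` {T. openin X T \<and> x \<in> T}"
  have "istopology (\<lambda>U. U \<subseteq> topspace X \<and> (\<forall>x\<in>U. \<exists>N\<in>?\<N> x. N \<subseteq> U))"
  proof (rule istopology_filtered_nhds)
    fix x M N assume "M \<in> ?\<N> x" "N \<in> ?\<N> x"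
    then obtain S T where "openin X S" "x \<in> S" "M = S \<inter> above r x"
        "openin X T" "x \<in> T" "N = T \<inter> above r x"
      by blast
    then show "\<exists>L\<in>?\<N> x. L \<subseteq> M \<inter> N"
      by (intro bexI[of _ "(S \<inter> T) \<inter> above r x"]) auto
  qed
  then show ?thesis
    by (simp add: sorgenfrey_topology_def Bex_def conj_assoc)
qed

lemma openin_imp_openin_sorgenfrey_topology:
  "openin X U \<Longrightarrow> openin (sorgenfrey_topology X r) U"
  unfolding openin_sorgenfrey_topology
  by (intro conjI ballI exI[of _ U] openin_subset) auto

lemma topspace_sorgenfrey_topology [simp]: "topspace (sorgenfrey_topology X r) = topspace X"
proof
  show "topspace (sorgenfrey_topology X r) \<subseteq> topspace X"
    using openin_topspace[of "sorgenfrey_topology X r"]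
    unfolding openin_sorgenfrey_topology by (rule conjunct1)
  show "topspace X \<subseteq> topspace (sorgenfrey_topology X r)"
    by (intro openin_subset openin_imp_openin_sorgenfrey_topology openin_topspace)
qed

lemma openin_sorgenfrey_topology_Int_above:
  assumes "trans r" "openin X T"
  shows "openin (sorgenfrey_topology X r) (T \<inter> above r x)"
proof -
  have "T \<inter> above r y \<subseteq> T \<inter> above r x" if "y \<in> above r x" for y
    using that transD[OF assms(1)] by (auto simp: above_def)
  then show ?thesis
    unfolding openin_sorgenfrey_topology
    using assms(2) openin_subset[OF assms(2)] by (intro conjI ballI exI[of _ T]) auto
qed

lemma weight_sorgenfrey_topology:
  assumes "preorder_on (topspace X) r" "weight X \<le>o \<kappa>" "|topspace X| \<le>o \<kappa>" "Cinfinite \<kappa>"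
  shows "weight (sorgenfrey_topology X r) \<le>o \<kappa>"
proof -
  obtain \<B> where \<B>: "topology_base X \<B>" "|\<B>| \<le>o \<kappa>"
    using assms(2) by (auto simp: weight_ordLeq_iff)
  let ?\<B> = "(\<lambda>(T, x). T \<inter> above r x) ` (\<B> \<times> topspace X)"
  have "topology_base (sorgenfrey_topology X r) ?\<B>"
    unfolding topology_base_def
  proof (intro conjI ballI allI impI)
    fix V assume "V \<in> ?\<B>"
    then show "openin (sorgenfrey_topology X r) V"
      using \<B>(1) assms(1)
      by (auto simp: topology_base_def preorder_on_def intro!: openin_sorgenfrey_topology_Int_above)
  next
    fix U x assume U: "openin (sorgenfrey_topology X r) U \<and> x \<in> U"
    then obtain T where T: "openin X T" "x \<in> T" "T \<inter> above r x \<subseteq> U"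
      unfolding openin_sorgenfrey_topology by blast
    obtain B where B: "B \<in> \<B>" "x \<in> B" "B \<subseteq> T"
      by (rule topology_base_openinE[OF \<B>(1) T(1,2)])
    have x: "x \<in> topspace X"
      using openin_subset[OF T(1)] T(2) by blast
    then have "x \<in> above r x"
      using assms(1) by (auto simp: above_def preorder_on_def refl_on_def)
    with x B T(3) show "\<exists>V\<in>?\<B>. x \<in> V \<and> V \<subseteq> U"
      by (intro bexI[of _ "B \<inter> above r x"]) auto
  qed
  moreover have "|?\<B>| \<le>o \<kappa>"
    using \<B>(2) assms(3,4)
    by (intro ordLeq_transitive[OF card_of_image] card_of_Times_ordLeq_infinite_Field)
       (auto simp: cinfinite_def)
  ultimately show ?thesis
    unfolding weight_ordLeq_iff by blast
qed

locale weakly_ordered_space =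
  fixes X :: "'a topology" and r :: "'a rel"
  assumes linear_order: "linear_order_on (topspace X) r"
    and closedin_under: "x \<in> topspace X \<Longrightarrow> closedin X (under r x)"
    and closedin_above: "x \<in> topspace X \<Longrightarrow> closedin X (above r x)"
begin

lemma rel_refl: "x \<in> topspace X \<Longrightarrow> (x, x) \<in> r"
  using linear_order by (simp add: order_on_defs refl_on_def)

lemma rel_antisym: "(x, y) \<in> r \<Longrightarrow> (y, x) \<in> r \<Longrightarrow> x = y"
  using linear_order by (simp add: order_on_defs antisym_def)

lemma rel_total: "x \<in> topspace X \<Longrightarrow> y \<in> topspace X \<Longrightarrow> (x, y) \<in> r \<or> (y, x) \<in> r"
  using linear_order rel_refl by (cases "x = y") (auto simp: order_on_defs total_on_def)

lemma weakly_ordered_space_converse: "weakly_ordered_space X (r\<inverse>)"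
  using linear_order closedin_under closedin_above
  by unfold_locales (simp_all add: under_def above_def)

lemma Hausdorff: "Hausdorff_space X"
proof -
  have separated: "\<exists>U V. openin X U \<and> openin X V \<and> x \<in> U \<and> y \<in> V \<and> disjnt U V"
    if xy: "(x, y) \<in> r" "x \<noteq> y" "x \<in> topspace X" "y \<in> topspace X" for x y
  proof (cases "\<exists>z\<in>topspace X. (z, x) \<notin> r \<and> (y, z) \<notin> r")
    case True
    then obtain z where z: "z \<in> topspace X" "(z, x) \<notin> r" "(y, z) \<notin> r"
      by blast
    have "disjnt (topspace X - above r z) (topspace X - under r z)"
      using rel_total[OF _ z(1)] by (auto simp: disjnt_def above_def under_def)
    then show ?thesis
      using xy z closedin_under closedin_above
      by (intro exI[of _ "topspace X - above r z"] exI[of _ "topspace X - under r z"])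
         (auto simp: above_def under_def)
  next
    case False
    then have "disjnt (topspace X - above r y) (topspace X - under r x)"
      by (auto simp: disjnt_def above_def under_def)
    then show ?thesis
      using xy closedin_under closedin_above rel_antisym
      by (intro exI[of _ "topspace X - above r y"] exI[of _ "topspace X - under r x"])
         (auto simp: above_def under_def)
  qed
  show ?thesis
    unfolding Hausdorff_space_def
    using separated rel_total by (metis disjnt_sym)
qed

lemma inj_on_outside_strict_right_halves:
  assumes "\<And>x. x \<in> topspace X \<Longrightarrow> x \<in> t x"
  shows "inj_on t (topspace X - (\<Union>x\<in>topspace X. t x - under r x))"
proof (rule inj_onI)
  let ?R = "topspace X - (\<Union>x\<in>topspace X. t x - under r x)"
  fix x y assume "x \<in> ?R" "y \<in> ?R" "t x = t y"
  then have "x \<in> under r y" "y \<in> under r x"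
    using assms[of x] assms[of y] by auto
  then show "x = y"
    using rel_antisym by (simp add: under_def)
qed

text \<open>The right halves of the \<open>t x\<close> without their end points \<open>x\<close> are open in \<open>X\<close>, so few of them
  cover as much as all; the points left uncovered are few by the preceding lemma.\<close>

lemma right_halves_subcover:
  assumes \<B>: "topology_base X \<B>" "|\<B>| \<le>o \<mu>" and \<mu>: "Cinfinite \<mu>"
    and t: "\<And>x. x \<in> topspace X \<Longrightarrow> t x \<in> \<B>" "\<And>x. x \<in> topspace X \<Longrightarrow> x \<in> t x"
  obtains D where "D \<subseteq> topspace X" "|D| \<le>o \<mu>" "topspace X \<subseteq> (\<Union>x\<in>D. t x \<inter> above r x)"
proof -
  define W where "W x = t x - under r x" for x
  have t_open: "openin X (t x)" if "x \<in> topspace X" for x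
    using t(1)[OF that] \<B>(1) by (simp add: topology_base_def)
  have W_half: "W x \<subseteq> t x \<inter> above r x" if "x \<in> topspace X" for x
    using rel_total[OF that] openin_subset[OF t_open[OF that]]
    by (auto simp: W_def under_def above_def)
  have "weight X \<le>o \<mu>"
    using \<B> by (auto simp: weight_ordLeq_iff)
  moreover have "openin X (W x)" if "x \<in> topspace X" for x
    unfolding W_def using that t_open closedin_under by (intro openin_diff)
  ultimately obtain C
    where C: "C \<subseteq> topspace X" "|C| \<le>o \<mu>" "(\<Union>x\<in>C. W x) = (\<Union>x\<in>topspace X. W x)"
    by (rule open_family_subfamily_ordLeq_weight)
  define R where "R = topspace X - (\<Union>x\<in>topspace X. W x)"
  have "inj_on t R"
    unfolding R_def W_def using t(2) by (rule inj_on_outside_strict_right_halves)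
  then have "|R| \<le>o |\<B>|"
    using t(1) by (intro card_of_ordLeqI[of t]) (auto simp: R_def)
  then have "|R| \<le>o \<mu>"
    using \<B>(2) by (rule ordLeq_transitive)
  with C(2) have "|C \<union> R| \<le>o \<mu>"
    using \<mu> by (rule Un_Cinfinite_bound)
  moreover have "C \<union> R \<subseteq> topspace X"
    using C(1) by (auto simp: R_def)
  moreover have "topspace X \<subseteq> (\<Union>x\<in>C \<union> R. t x \<inter> above r x)"
  proof -
    have "topspace X \<subseteq> (\<Union>x\<in>C. W x) \<union> R"
      unfolding C(3) by (auto simp: R_def)
    also have "\<dots> \<subseteq> (\<Union>x\<in>C. t x \<inter> above r x) \<union> (\<Union>x\<in>R. t x \<inter> above r x)"
    proof (rule Un_mono)
      show "(\<Union>x\<in>C. W x) \<subseteq> (\<Union>x\<in>C. t x \<inter> above r x)"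
        using W_half C(1) by (intro UN_mono) auto
      show "R \<subseteq> (\<Union>x\<in>R. t x \<inter> above r x)"
        using t(2) rel_refl by (auto simp: R_def above_def)
    qed
    finally show ?thesis
      by (simp only: UN_Un)
  qed
  ultimately show thesis
    using that by blast
qed

lemma kappa_compact_sorgenfrey_topology:
  assumes w: "weight X \<le>o \<mu>" and \<mu>: "Cinfinite \<mu>"
  shows "kappa_compact (cardSuc \<mu>) (sorgenfrey_topology X r)"
proof (rule kappa_compactI)
  let ?S = "sorgenfrey_topology X r"
  fix \<U> assume \<U>: "\<And>U. U \<in> \<U> \<Longrightarrow> openin ?S U" "topspace ?S \<subseteq> \<Union>\<U>"
  obtain \<B> where \<B>: "topology_base X \<B>" "|\<B>| \<le>o \<mu>"
    using w by (auto simp: weight_ordLeq_iff)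
  have "\<exists>U\<in>\<U>. \<exists>B\<in>\<B>. x \<in> B \<and> B \<inter> above r x \<subseteq> U" if x: "x \<in> topspace X" for x
  proof -
    obtain U where U: "U \<in> \<U>" "x \<in> U"
      using \<U>(2) x by auto
    then obtain T where T: "openin X T" "x \<in> T" "T \<inter> above r x \<subseteq> U"
      using \<U>(1) unfolding openin_sorgenfrey_topology by meson
    show ?thesis
      by (rule topology_base_openinE[OF \<B>(1) T(1,2)]) (use U(1) T(3) in blast)
  qed
  then obtain u t where u: "\<And>x. x \<in> topspace X \<Longrightarrow> u x \<in> \<U>"
    and t: "\<And>x. x \<in> topspace X \<Longrightarrow> t x \<in> \<B>" "\<And>x. x \<in> topspace X \<Longrightarrow> x \<in> t x"
    and tu: "\<And>x. x \<in> topspace X \<Longrightarrow> t x \<inter> above r x \<subseteq> u x"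
    by metis
  obtain D where D: "D \<subseteq> topspace X" "|D| \<le>o \<mu>" "topspace X \<subseteq> (\<Union>x\<in>D. t x \<inter> above r x)"
    using \<B> \<mu> t by (rule right_halves_subcover)
  have "|u ` D| \<le>o \<mu>"
    using card_of_image D(2) by (rule ordLeq_transitive)
  then have "|u ` D| <o cardSuc \<mu>"
    using \<mu> by (simp add: cardSuc_ordLeq_ordLess card_of_Card_order)
  moreover have "u ` D \<subseteq> \<U>"
    using u D(1) by blast
  moreover have "topspace ?S \<subseteq> \<Union>(u ` D)"
  proof
    fix x assume "x \<in> topspace ?S"
    then obtain y where "y \<in> D" "x \<in> t y \<inter> above r y"
      using subsetD[OF D(3)] by auto
    then show "x \<in> \<Union>(u ` D)"
      using tu D(1) by (meson UN_I subsetD)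
  qed
  ultimately show "\<exists>\<V>\<subseteq>\<U>. |\<V>| <o cardSuc \<mu> \<and> topspace ?S \<subseteq> \<Union>\<V>"
    by blast
qed

end

definition double_sorgenfrey :: "'a topology \<Rightarrow> 'a rel \<Rightarrow> (bool \<times> 'a) topology" where
  "double_sorgenfrey X r =
     sum_topology (\<lambda>b. sorgenfrey_topology X (if b then r else r\<inverse>)) UNIV"

lemma topspace_double_sorgenfrey [simp]: "topspace (double_sorgenfrey X r) = UNIV \<times> topspace X"
  by (auto simp: double_sorgenfrey_def)

lemma continuous_map_double_sorgenfrey_snd: "continuous_map (double_sorgenfrey X r) X snd"
  unfolding continuous_map
proof (intro conjI allI impI)
  fix U assume U: "openin X U"
  have "openin (double_sorgenfrey X r) (UNIV \<times> U)"
    unfolding double_sorgenfrey_def openin_disjoint_union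
    using openin_imp_openin_sorgenfrey_topology[OF U] by blast
  moreover have "{p \<in> topspace (double_sorgenfrey X r). snd p \<in> U} = UNIV \<times> U"
    using openin_subset[OF U] by auto
  ultimately show "openin (double_sorgenfrey X r) {p \<in> topspace (double_sorgenfrey X r). snd p \<in> U}"
    by simp
qed auto

definition crossed_diagonal :: "'a set \<Rightarrow> ((bool \<times> 'a) \<times> (bool \<times> 'a)) set" where
  "crossed_diagonal S = (\<lambda>x. ((True, x), (False, x))) ` S"

context weakly_ordered_space
begin

lemma weight_double_sorgenfrey:
  assumes "weight X \<le>o \<kappa>" "|topspace X| \<le>o \<kappa>" "Cinfinite \<kappa>"
  shows "weight (double_sorgenfrey X r) \<le>o \<kappa>"
  unfolding double_sorgenfrey_def
proof (rule weight_sum_topology[OF _ assms(3)])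
  show "|UNIV :: bool set| \<le>o \<kappa>"
    using ctwo_ordLeq_Cinfinite[OF assms(3)] by (simp add: ctwo_def)
next
  fix b
  have "preorder_on (topspace X) (if b then r else r\<inverse>)"
    using linear_order by (simp add: linear_order_on_def partial_order_on_def)
  then show "weight (sorgenfrey_topology X (if b then r else r\<inverse>)) \<le>o \<kappa>"
    using assms by (rule weight_sorgenfrey_topology)
qed

lemma kappa_compact_double_sorgenfrey:
  assumes "weight X \<le>o \<mu>" "Cinfinite \<mu>"
  shows "kappa_compact (cardSuc \<mu>) (double_sorgenfrey X r)"
  unfolding double_sorgenfrey_def
proof (rule kappa_compact_sum_topology)
  show "regularCard (cardSuc \<mu>)" "Cinfinite (cardSuc \<mu>)"
    using assms(2) by (rule regularCard_cardSuc, rule Cinfinite_cardSuc)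
  then show "|UNIV :: bool set| <o cardSuc \<mu>"
    using ctwo_ordLess_Cinfinite by (simp add: ctwo_def)
  interpret converse: weakly_ordered_space X "r\<inverse>"
    by (rule weakly_ordered_space_converse)
  show "kappa_compact (cardSuc \<mu>) (sorgenfrey_topology X (if b then r else r\<inverse>))" for b
    using kappa_compact_sorgenfrey_topology[OF assms]
      converse.kappa_compact_sorgenfrey_topology[OF assms] by simp
qed

lemma closedin_crossed_diagonal:
  "closedin (prod_topology (double_sorgenfrey X r) (double_sorgenfrey X r))
     (crossed_diagonal (topspace X))"
proof -
  let ?Z = "double_sorgenfrey X r" and ?\<Delta> = "(\<lambda>x. (x, x)) ` topspace X"
  let ?P = "prod_topology ?Z ?Z" and ?f = "\<lambda>(p, q). (snd p, snd q)"
  have "closedin (sorgenfrey_topology X s) (topspace X)" for s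
    using closedin_topspace[of "sorgenfrey_topology X s"] by simp
  then have summand: "closedin ?Z ({b} \<times> topspace X)" for b
    unfolding double_sorgenfrey_def by (intro closedin_sum_topology_summand UNIV_I)
  have "continuous_map ?P (prod_topology X X) ?f"
    by (simp add: continuous_map_prod_top continuous_map_double_sorgenfrey_snd)
  moreover have "closedin (prod_topology X X) ?\<Delta>"
    using Hausdorff by (simp add: Hausdorff_space_closedin_diagonal)
  ultimately have "closedin ?P {p \<in> topspace ?P. ?f p \<in> ?\<Delta>}"
    by (rule closedin_continuous_map_preimage)
  then have "closedin ?P ({p \<in> topspace ?P. ?f p \<in> ?\<Delta>} \<inter>
      ({True} \<times> topspace X) \<times> ({False} \<times> topspace X))"
    using summand by (intro closedin_Int) (simp_all add: closedin_prod_Times_iff)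
  also have "{p \<in> topspace ?P. ?f p \<in> ?\<Delta>} \<inter>
      ({True} \<times> topspace X) \<times> ({False} \<times> topspace X) = crossed_diagonal (topspace X)"
    by (auto simp: crossed_diagonal_def)
  finally show ?thesis .
qed

lemma subtopology_crossed_diagonal:
  "subtopology (prod_topology (double_sorgenfrey X r) (double_sorgenfrey X r))
     (crossed_diagonal (topspace X)) = discrete_topology (crossed_diagonal (topspace X))"
proof -
  let ?Z = "double_sorgenfrey X r" and ?D = "crossed_diagonal (topspace X)"
  let ?P = "prod_topology ?Z ?Z"
  define N where
    "N x = ({True} \<times> (topspace X \<inter> above r x)) \<times> ({False} \<times> (topspace X \<inter> under r x))" for x
  have "openin (subtopology ?P ?D) {((True, x), (False, x))}" if x: "x \<in> topspace X" for x
  proof -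
    have "trans r"
      using linear_order by (simp add: order_on_defs)
    then have "openin ?Z ({b} \<times> (topspace X \<inter> above (if b then r else r\<inverse>) x))" for b
      unfolding double_sorgenfrey_def
      by (intro openin_sum_topology_summand openin_sorgenfrey_topology_Int_above) simp_all
    from this[of True] this[of False] have "openin ?P (N x)"
      by (simp add: N_def openin_prod_Times_iff under_def above_def)
    moreover have "N x \<inter> ?D = {((True, x), (False, x))}"
      using x rel_refl rel_antisym by (auto simp: N_def crossed_diagonal_def above_def under_def)
    ultimately show ?thesis
      by (metis openin_subtopology_Int)
  qed
  moreover have "?D \<subseteq> topspace ?P"
    by (auto simp: crossed_diagonal_def)
  ultimately have "discrete_topology ?D = subtopology ?P ?D"
    unfolding discrete_topology_unique by (auto simp: crossed_diagonal_def)
  then show ?thesis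
    by (rule sym)
qed

lemma not_kappa_compact_square_double_sorgenfrey:
  assumes "\<kappa> \<le>o |topspace X|"
  shows "\<not> kappa_compact \<kappa> (prod_topology (double_sorgenfrey X r) (double_sorgenfrey X r))"
proof
  assume "kappa_compact \<kappa> (prod_topology (double_sorgenfrey X r) (double_sorgenfrey X r))"
  then have "|crossed_diagonal (topspace X)| <o \<kappa>"
    using closedin_crossed_diagonal subtopology_crossed_diagonal
    by (rule kappa_compact_closed_discrete_ordLess)
  moreover have "|topspace X| \<le>o |crossed_diagonal (topspace X)|"
    by (rule card_of_ordLeqI[of "\<lambda>x. ((True, x), (False, x))"])
       (auto simp: crossed_diagonal_def inj_on_def)
  ultimately show False
    using assms ordLeq_transitive not_ordLess_ordLeq by blast
qed

lemma not_square_compact: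
  assumes "Cinfinite \<mu>" "\<mu> <o \<kappa>" "|topspace X| =o \<kappa>" "weight X \<le>o \<mu>"
  shows "\<not> square_compact \<kappa>"
proof
  assume "square_compact \<kappa>"
  have "Card_order \<kappa>"
    using assms(3) by (rule ordIso_card_of_imp_Card_order[OF ordIso_symmetric])
  then have "cardSuc \<mu> \<le>o \<kappa>"
    using assms(1,2) by (simp add: cardSuc_least)
  then have "kappa_compact \<kappa> (double_sorgenfrey X r)"
    using kappa_compact_mono kappa_compact_double_sorgenfrey[OF assms(4,1)] by blast
  moreover have "\<mu> \<le>o \<kappa>"
    using assms(2) by (rule ordLess_imp_ordLeq)
  then have "weight (double_sorgenfrey X r) \<le>o \<kappa>"
    using assms \<open>Card_order \<kappa>\<close> cinfinite_mono ordLeq_transitive ordIso_imp_ordLeq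
    by (intro weight_double_sorgenfrey) blast+
  ultimately have "kappa_compact \<kappa> (prod_topology (double_sorgenfrey X r) (double_sorgenfrey X r))"
    using \<open>square_compact \<kappa>\<close> square_compact_any_type by blast
  then show False
    using not_kappa_compact_square_double_sorgenfrey assms(3) ordIso_iff_ordLeq by blast
qed

end

subsection \<open>Lexicographically ordered sets of functions\<close>

text \<open>Below the first difference of \<open>x\<close> and \<open>y\<close> the condition holds by reflexivity, and above it
  there is no condition.\<close>

definition lex_order :: "'t rel \<Rightarrow> 'm rel \<Rightarrow> ('t \<Rightarrow> 'm) set \<Rightarrow> ('t \<Rightarrow> 'm) rel" where
  "lex_order \<theta> \<mu> S =
     {(x, y) \<in> S \<times> S. \<forall>\<delta>\<in>Field \<theta>. (\<forall>\<beta>\<in>underS \<theta> \<delta>. x \<beta> = y \<beta>) \<longrightarrow> (x \<delta>, y \<delta>) \<in> \<mu>}"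

lemma lex_order_agree_between:
  assumes "Well_order \<theta>" "antisym \<mu>"
    and xy: "(x, y) \<in> lex_order \<theta> \<mu> S" and yz: "(y, z) \<in> lex_order \<theta> \<mu> S"
    and xz: "\<And>\<beta>. \<beta> \<in> underS \<theta> \<delta> \<Longrightarrow> x \<beta> = z \<beta>"
  shows "\<beta> \<in> underS \<theta> \<delta> \<Longrightarrow> x \<beta> = y \<beta>"
proof (induction \<beta> rule: wo_rel.well_order_induct[OF wo_rel.intro[OF assms(1)], case_names less])
  case (less \<beta>)
  have "\<beta> \<in> Field \<theta>"
    using less.prems underS_Field by fast
  have "underS \<theta> \<beta> \<subseteq> underS \<theta> \<delta>"
    using assms(1) less.prems by (intro underS_incr) (simp_all add: order_on_defs underS_def)
  then have "\<forall>\<gamma>\<in>underS \<theta> \<beta>. x \<gamma> = y \<gamma>" "\<forall>\<gamma>\<in>underS \<theta> \<beta>. x \<gamma> = z \<gamma>"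
    using less.IH xz by (auto simp: underS_def)
  then have "(x \<beta>, y \<beta>) \<in> \<mu>" "(y \<beta>, z \<beta>) \<in> \<mu>"
    using \<open>\<beta> \<in> Field \<theta>\<close> xy yz by (auto simp: lex_order_def)
  then show "x \<beta> = y \<beta>"
    using assms(2) xz[OF less.prems] by (simp add: antisym_def)
qed

lemma trans_lex_order:
  assumes "Well_order \<theta>" "antisym \<mu>" "trans \<mu>"
  shows "trans (lex_order \<theta> \<mu> S)"
proof (rule transI)
  fix x y z assume xy: "(x, y) \<in> lex_order \<theta> \<mu> S" and yz: "(y, z) \<in> lex_order \<theta> \<mu> S"
  have "(x \<delta>, z \<delta>) \<in> \<mu>" if \<delta>: "\<delta> \<in> Field \<theta>" and agree: "\<forall>\<beta>\<in>underS \<theta> \<delta>. x \<beta> = z \<beta>" for \<delta>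
  proof -
    have "\<forall>\<beta>\<in>underS \<theta> \<delta>. x \<beta> = y \<beta>"
      using lex_order_agree_between[OF assms(1,2) xy yz] agree by blast
    then have "(x \<delta>, y \<delta>) \<in> \<mu>" "(y \<delta>, z \<delta>) \<in> \<mu>"
      using xy yz \<delta> agree by (auto simp: lex_order_def)
    then show ?thesis
      by (rule transD[OF assms(3)])
  qed
  then show "(x, z) \<in> lex_order \<theta> \<mu> S"
    using xy yz by (simp add: lex_order_def)
qed

lemma antisym_lex_order:
  assumes "Well_order \<theta>" "antisym \<mu>" "S \<subseteq> Func (Field \<theta>) B"
  shows "antisym (lex_order \<theta> \<mu> S)"
proof (rule antisymI)
  fix x y assume xy: "(x, y) \<in> lex_order \<theta> \<mu> S" and yx: "(y, x) \<in> lex_order \<theta> \<mu> S"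
  have "x \<delta> = y \<delta>" if "\<delta> \<in> Field \<theta>" for \<delta>
  proof -
    have "\<forall>\<beta>\<in>underS \<theta> \<delta>. x \<beta> = y \<beta>"
      using lex_order_agree_between[OF assms(1,2) xy yx] by blast
    then have "(x \<delta>, y \<delta>) \<in> \<mu>" "(y \<delta>, x \<delta>) \<in> \<mu>"
      using xy yx that by (auto simp: lex_order_def)
    then show ?thesis
      by (rule antisymD[OF assms(2)])
  qed
  moreover have "x \<in> Func (Field \<theta>) B" "y \<in> Func (Field \<theta>) B"
    using xy assms(3) by (auto simp: lex_order_def)
  ultimately show "x = y"
    unfolding Func_def by fastforce
qed

lemma total_on_lex_order:
  assumes \<theta>: "total_on (Field \<theta>) \<theta>" and \<mu>: "Refl \<mu>" "Total \<mu>" and S: "S \<subseteq> Func (Field \<theta>) (Field \<mu>)"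
  shows "total_on S (lex_order \<theta> \<mu> S)"
proof (rule total_onI, rule ccontr)
  fix x y
  assume xy: "x \<in> S" "y \<in> S" and "\<not> ((x, y) \<in> lex_order \<theta> \<mu> S \<or> (y, x) \<in> lex_order \<theta> \<mu> S)"
  then obtain \<delta> \<epsilon>
    where \<delta>: "\<delta> \<in> Field \<theta>" "\<forall>\<beta>\<in>underS \<theta> \<delta>. x \<beta> = y \<beta>" "(x \<delta>, y \<delta>) \<notin> \<mu>"
      and \<epsilon>: "\<epsilon> \<in> Field \<theta>" "\<forall>\<beta>\<in>underS \<theta> \<epsilon>. y \<beta> = x \<beta>" "(y \<epsilon>, x \<epsilon>) \<notin> \<mu>"
    by (auto simp: lex_order_def)
  have in_Field: "x \<alpha> \<in> Field \<mu>" "y \<alpha> \<in> Field \<mu>" if "\<alpha> \<in> Field \<theta>" for \<alpha>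
    using xy S that by (auto simp: Func_def)
  then have "x \<delta> \<noteq> y \<delta>" "x \<epsilon> \<noteq> y \<epsilon>"
    using \<mu>(1) \<delta>(1,3) \<epsilon>(1,3) by (metis refl_onD)+
  then have "\<delta> \<notin> underS \<theta> \<epsilon>" "\<epsilon> \<notin> underS \<theta> \<delta>"
    using \<delta>(2) \<epsilon>(2) by auto
  then have "\<delta> = \<epsilon>"
    using \<theta> \<delta>(1) \<epsilon>(1) by (auto simp: total_on_def underS_def)
  then show False
    using \<mu>(2) in_Field[OF \<delta>(1)] \<open>x \<delta> \<noteq> y \<delta>\<close> \<delta>(3) \<epsilon>(3) by (auto simp: total_on_def)
qed

lemma linear_order_on_lex_order:
  assumes \<theta>: "Well_order \<theta>" and \<mu>: "Linear_order \<mu>" and S: "S \<subseteq> Func (Field \<theta>) (Field \<mu>)"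
  shows "linear_order_on S (lex_order \<theta> \<mu> S)"
proof -
  have \<mu>_props: "Refl \<mu>" "trans \<mu>" "antisym \<mu>" "Total \<mu>" and "Total \<theta>"
    using \<mu> \<theta> by (simp_all add: order_on_defs)
  have "(x \<delta>, x \<delta>) \<in> \<mu>" if "x \<in> S" "\<delta> \<in> Field \<theta>" for x \<delta>
    using \<mu>_props(1) S that by (auto simp: refl_on_def Func_def)
  then have "refl_on S (lex_order \<theta> \<mu> S)"
    by (simp add: lex_order_def refl_on_def)
  moreover have "lex_order \<theta> \<mu> S \<subseteq> S \<times> S"
    by (auto simp: lex_order_def)
  ultimately show ?thesis
    using trans_lex_order[OF \<theta> \<mu>_props(3,2)] antisym_lex_order[OF \<theta> \<mu>_props(3) S]
      total_on_lex_order[OF \<open>Total \<theta>\<close> \<mu>_props(1,4) S]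
    by (simp add: order_on_defs)
qed

definition initial_cone :: "'t rel \<Rightarrow> ('t \<Rightarrow> 'm) set \<Rightarrow> 't \<Rightarrow> ('t \<Rightarrow> 'm) \<Rightarrow> ('t \<Rightarrow> 'm) set" where
  "initial_cone \<theta> S \<alpha> x = {y \<in> S. \<forall>\<beta>\<in>under \<theta> \<alpha>. y \<beta> = x \<beta>}"

definition cone_topology :: "'t rel \<Rightarrow> ('t \<Rightarrow> 'm) set \<Rightarrow> ('t \<Rightarrow> 'm) topology" where
  "cone_topology \<theta> S =
     topology (\<lambda>U. U \<subseteq> S \<and> (\<forall>x\<in>U. \<exists>\<alpha>\<in>Field \<theta>. initial_cone \<theta> S \<alpha> x \<subseteq> U))"

lemma openin_cone_topology:
  assumes "Linear_order \<theta>"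
  shows "openin (cone_topology \<theta> S) U \<longleftrightarrow>
    U \<subseteq> S \<and> (\<forall>x\<in>U. \<exists>\<alpha>\<in>Field \<theta>. initial_cone \<theta> S \<alpha> x \<subseteq> U)"
proof -
  let ?\<N> = "\<lambda>x. (\<lambda>\<alpha>. initial_cone \<theta> S \<alpha> x) ` Field \<theta>"
  have "istopology (\<lambda>U. U \<subseteq> S \<and> (\<forall>x\<in>U. \<exists>N\<in>?\<N> x. N \<subseteq> U))"
  proof (rule istopology_filtered_nhds)
    fix x M N assume "M \<in> ?\<N> x" "N \<in> ?\<N> x"
    then obtain \<alpha> \<beta>
      where \<alpha>\<beta>: "\<alpha> \<in> Field \<theta>" "M = initial_cone \<theta> S \<alpha> x" "\<beta> \<in> Field \<theta>" "N = initial_cone \<theta> S \<beta> x"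
      by blast
    then have "(\<alpha>, \<beta>) \<in> \<theta> \<or> (\<beta>, \<alpha>) \<in> \<theta>"
      using assms by (cases "\<alpha> = \<beta>") (auto simp: order_on_defs total_on_def refl_on_def)
    then have "under \<theta> \<alpha> \<subseteq> under \<theta> \<beta> \<or> under \<theta> \<beta> \<subseteq> under \<theta> \<alpha>"
      using under_incr[of \<theta>] assms by (auto simp: order_on_defs)
    then have "M \<subseteq> N \<or> N \<subseteq> M"
      unfolding \<alpha>\<beta>(2,4) initial_cone_def by blast
    then show "\<exists>L\<in>?\<N> x. L \<subseteq> M \<inter> N"
      using \<open>M \<in> ?\<N> x\<close> \<open>N \<in> ?\<N> x\<close> by blast
  qed
  then show ?thesis
    by (simp add: cone_topology_def)
qed

lemma topspace_cone_topology:
  assumes "Linear_order \<theta>" "Field \<theta> \<noteq> {}"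
  shows "topspace (cone_topology \<theta> S) = S"
proof
  show "topspace (cone_topology \<theta> S) \<subseteq> S"
    using openin_topspace[of "cone_topology \<theta> S"]
    unfolding openin_cone_topology[OF assms(1)] by (rule conjunct1)
  have "openin (cone_topology \<theta> S) S"
    using assms(2) unfolding openin_cone_topology[OF assms(1)] by (auto simp: initial_cone_def)
  then show "S \<subseteq> topspace (cone_topology \<theta> S)"
    by (rule openin_subset)
qed

lemma openin_initial_cone:
  assumes "Linear_order \<theta>" "\<alpha> \<in> Field \<theta>"
  shows "openin (cone_topology \<theta> S) (initial_cone \<theta> S \<alpha> x)"
  unfolding openin_cone_topology[OF assms(1)] using assms(2)
  by (auto simp: initial_cone_def intro!: bexI[of _ \<alpha>])

lemma weight_cone_topology:
  assumes \<theta>: "Linear_order \<theta>" and S: "S \<subseteq> Func (Field \<theta>) B" and \<mu>: "Cinfinite \<mu>"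
    and le: "|Field \<theta>| \<le>o \<mu>" "\<And>\<alpha>. \<alpha> \<in> Field \<theta> \<Longrightarrow> |Func (under \<theta> \<alpha>) B| \<le>o \<mu>"
  shows "weight (cone_topology \<theta> S) \<le>o \<mu>"
proof -
  let ?\<B> = "(\<lambda>(\<alpha>, g). initial_cone \<theta> S \<alpha> g) ` (SIGMA \<alpha>:Field \<theta>. Func (under \<theta> \<alpha>) B)"
  have "topology_base (cone_topology \<theta> S) ?\<B>"
    unfolding topology_base_def
  proof (intro conjI ballI allI impI)
    fix V assume "V \<in> ?\<B>"
    then show "openin (cone_topology \<theta> S) V"
      using openin_initial_cone[OF \<theta>] by auto
  next
    fix U x assume U: "openin (cone_topology \<theta> S) U \<and> x \<in> U"
    then obtain \<alpha> where \<alpha>: "\<alpha> \<in> Field \<theta>" "initial_cone \<theta> S \<alpha> x \<subseteq> U"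
      unfolding openin_cone_topology[OF \<theta>] by blast
    have x: "x \<in> S"
      using U unfolding openin_cone_topology[OF \<theta>] by blast
    let ?g = "restrict x (under \<theta> \<alpha>)"
    have "?g \<in> Func (under \<theta> \<alpha>) B"
      using x S under_Field[of \<theta> \<alpha>] by (force simp: Func_def)
    then have "initial_cone \<theta> S \<alpha> ?g \<in> ?\<B>"
      using \<alpha>(1) by (intro image_eqI[of _ _ "(\<alpha>, ?g)"]) auto
    moreover have "initial_cone \<theta> S \<alpha> ?g = initial_cone \<theta> S \<alpha> x"
      by (simp add: initial_cone_def)
    ultimately show "\<exists>V\<in>?\<B>. x \<in> V \<and> V \<subseteq> U"
      using \<alpha>(2) x by (intro bexI[of _ "initial_cone \<theta> S \<alpha> x"]) (auto simp: initial_cone_def)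
  qed
  moreover have "|?\<B>| \<le>o \<mu>"
    using \<mu> le by (intro ordLeq_transitive[OF card_of_image] card_of_Sigma_ordLeq_infinite_Field)
      (auto simp: cinfinite_def)
  ultimately show ?thesis
    unfolding weight_ordLeq_iff by blast
qed

lemma initial_cones_preserving_not_lex_order:
  assumes "Refl \<theta>" "x \<in> S" "y \<in> S" "(x, y) \<notin> lex_order \<theta> \<mu> S"
  obtains \<delta> where "\<delta> \<in> Field \<theta>" "initial_cone \<theta> S \<delta> x \<subseteq> {z \<in> S. (z, y) \<notin> lex_order \<theta> \<mu> S}"
    "initial_cone \<theta> S \<delta> y \<subseteq> {z \<in> S. (x, z) \<notin> lex_order \<theta> \<mu> S}"
proof -
  obtain \<delta> where \<delta>: "\<delta> \<in> Field \<theta>" "\<forall>\<beta>\<in>underS \<theta> \<delta>. x \<beta> = y \<beta>" "(x \<delta>, y \<delta>) \<notin> \<mu>"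
    using assms(2-4) by (auto simp: lex_order_def)
  then have "under \<theta> \<delta> = underS \<theta> \<delta> \<union> {\<delta>}"
    using assms(1) by (intro Refl_under_underS)
  with \<delta> show thesis
    by (intro that[of \<delta>]) (auto simp: initial_cone_def lex_order_def intro!: bexI[of _ \<delta>])
qed

lemma weakly_ordered_space_cone_topology:
  assumes \<theta>: "Well_order \<theta>" "Field \<theta> \<noteq> {}" and \<mu>: "Linear_order \<mu>"
    and S: "S \<subseteq> Func (Field \<theta>) (Field \<mu>)"
  shows "weakly_ordered_space (cone_topology \<theta> S) (lex_order \<theta> \<mu> S)"
proof -
  let ?X = "cone_topology \<theta> S" and ?L = "lex_order \<theta> \<mu> S"
  have lin: "Linear_order \<theta>"
    using \<theta>(1) by (simp add: well_order_on_def)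
  have top: "topspace ?X = S"
    using lin \<theta>(2) by (rule topspace_cone_topology)
  show ?thesis
  proof
    show "linear_order_on (topspace ?X) ?L"
      unfolding top using \<theta>(1) \<mu> S by (rule linear_order_on_lex_order)
  next
    fix x assume x: "x \<in> topspace ?X"
    have refl: "Refl \<theta>"
      using lin by (simp add: order_on_defs)
    have "\<exists>\<alpha>\<in>Field \<theta>. initial_cone \<theta> S \<alpha> y \<subseteq> S - above ?L x"
      if y: "y \<in> S - above ?L x" for y
      by (rule initial_cones_preserving_not_lex_order[OF refl, of x S y \<mu>])
         (use x y in \<open>auto simp: top above_def set_diff_eq\<close>)
    moreover have "\<exists>\<alpha>\<in>Field \<theta>. initial_cone \<theta> S \<alpha> y \<subseteq> S - under ?L x"
      if y: "y \<in> S - under ?L x" for y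
      by (rule initial_cones_preserving_not_lex_order[OF refl, of y S x \<mu>])
         (use x y in \<open>auto simp: top under_def set_diff_eq\<close>)
    ultimately have "openin ?X (S - above ?L x)" "openin ?X (S - under ?L x)"
      unfolding openin_cone_topology[OF lin] by blast+
    moreover have "above ?L x \<subseteq> S" "under ?L x \<subseteq> S"
      by (auto simp: above_def under_def lex_order_def)
    ultimately show "closedin ?X (under ?L x)" "closedin ?X (above ?L x)"
      by (simp_all add: closedin_def top)
  qed
qed

subsection \<open>Cardinal exponentiation\<close>

lemma subset_card_of_ordIsoE:
  assumes "Card_order r" "r \<le>o |A|"
  obtains B where "B \<subseteq> A" "|B| =o r"
proof -
  obtain p where "Field p \<subseteq> A" "r =o p"
    using assms(2) internalize_ordLeq[of r "|A|"] by (auto simp: Field_card_of)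
  moreover from this have "|Field p| =o p"
    using assms(1) Card_order_ordIso2 card_of_Field_ordIso by blast
  ultimately show thesis
    using that ordIso_symmetric ordIso_transitive by blast
qed

lemma card_of_under_ordLess:
  assumes "Cinfinite r" "a \<in> Field r"
  shows "|under r a| <o r"
proof -
  have "under r a = underS r a \<union> {a}"
    using assms by (intro Refl_under_underS) (simp_all add: card_order_on_def order_on_defs)
  moreover have "|{a}| <o r"
    using assms(1)
    by (intro Cfinite_ordLess_Cinfinite)
       (simp_all add: cfinite_def Field_card_of card_of_card_order_on)
  ultimately show ?thesis
    using assms card_of_underS[of r a] by (simp only: Un_Cinfinite_bound_strict)
qed

lemma card_of_Func_finite_infinite:
  assumes "finite A" "infinite B"
  shows "|Func A B| \<le>o |B|"
  using assms(1)
proof (induction A)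
  case empty
  have "|{\<lambda>_. undefined :: 'b}| \<le>o |B|"
    using assms(2) by (intro card_of_singl_ordLeq) auto
  then show ?case
    by (simp add: Func_empty)
next
  case (insert a A)
  have "|Func (insert a A) B| \<le>o |B \<times> Func A B|"
  proof (rule card_of_ordLeqI)
    show "inj_on (\<lambda>f. (f a, f(a := undefined))) (Func (insert a A) B)"
      by (rule inj_onI) (metis fst_conv snd_conv fun_upd_triv fun_upd_upd)
    show "(f a, f(a := undefined)) \<in> B \<times> Func A B" if "f \<in> Func (insert a A) B" for f
      using that insert.hyps(2) by (auto simp: Func_def)
  qed
  moreover have "|B \<times> Func A B| \<le>o |B|"
    using assms(2) insert.IH
    by (intro card_of_Times_ordLeq_infinite_Field)
       (simp_all add: Field_card_of card_of_card_order_on card_of_refl ordIso_imp_ordLeq)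
  ultimately show ?case
    by (rule ordLeq_transitive)
qed

lemma cinfinite_cexp_imp_ctwo_ordLeq:
  assumes "Card_order \<mu>" "cinfinite (\<mu> ^c \<theta>)"
  shows "ctwo \<le>o \<mu>"
proof (cases "\<exists>a\<in>Field \<mu>. \<exists>b\<in>Field \<mu>. a \<noteq> b")
  case True
  then obtain a b where "a \<in> Field \<mu>" "b \<in> Field \<mu>" "a \<noteq> b"
    by blast
  then have "ctwo \<le>o |Field \<mu>|"
    unfolding ctwo_def
    by (intro card_of_ordLeqI[of "\<lambda>c. if c then a else b"]) (auto simp: inj_on_def)
  then show ?thesis
    using assms(1) card_of_Field_ordIso ordLeq_ordIso_trans by blast
next
  case False
  have "f = g" if "f \<in> Func (Field \<theta>) (Field \<mu>)" "g \<in> Func (Field \<theta>) (Field \<mu>)" for f g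
    using that False unfolding Func_def by fastforce
  then have "finite (Func (Field \<theta>) (Field \<mu>))"
    by (metis finite.emptyI finite_insert finite_subset insertI1 subsetI equals0I)
  then show ?thesis
    using assms(2) by (simp add: cinfinite_def cexp_def Field_card_of)
qed

lemma cinfinite_cexp_imp_Cinfinite_base:
  assumes "Card_order \<mu>" "\<theta> \<le>o \<mu>" "cinfinite (\<mu> ^c \<theta>)"
  shows "Cinfinite \<mu>"
proof (rule ccontr)
  assume "\<not> Cinfinite \<mu>"
  then have \<mu>: "finite (Field \<mu>)"
    using assms(1) by (simp add: cinfinite_def)
  then have "finite (Field \<theta>)"
    using card_of_ordLeq_finite[OF card_of_mono2[OF assms(2)]] by blast
  then have "finite (Func (Field \<theta>) (Field \<mu>))"
    by (intro rev_finite_subset[OF finite_set_of_finite_funs[OF _ \<mu>, of "Field \<theta>" undefined]])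
       (auto simp: Func_def)
  then show False
    using assms(3) by (simp add: cinfinite_def cexp_def Field_card_of)
qed

lemma ordLess_cexp_imp_Cinfinite_exponent:
  assumes "Cinfinite \<mu>" "Card_order \<theta>" "\<mu> <o \<mu> ^c \<theta>"
  shows "Cinfinite \<theta>"
proof (rule ccontr)
  assume "\<not> Cinfinite \<theta>"
  then have "\<mu> ^c \<theta> \<le>o |Field \<mu>|"
    using assms(1,2) unfolding cexp_def
    by (intro card_of_Func_finite_infinite) (simp_all add: cinfinite_def)
  then show False
    using assms(1,3) card_of_Field_ordIso ordLeq_ordIso_trans not_ordLess_ordLeq by blast
qed

lemma cexp_ordLeq_cexp_less:
  fixes \<theta> :: "'t rel"
  assumes "Card_order \<mu>" "Card_order \<nu>" "\<nu> <o \<theta>"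
  shows "\<mu> ^c \<nu> \<le>o cexp_less \<mu> \<theta>"
proof -
  obtain \<nu>' :: "'t rel" where \<nu>': "\<nu> =o \<nu>'" "\<nu>' <o \<theta>"
    using assms(3) internalize_ordLess[of \<nu> \<theta>] by blast
  then have "Card_order \<nu>'"
    using assms(2) Card_order_ordIso2 by blast
  then have "\<mu> ^c \<nu>' \<le>o cexp_less \<mu> \<theta>"
    using \<nu>'(2) cexp_less_is_least_bound(1) unfolding cexp_less_bound_def by blast
  moreover have "\<mu> ^c \<nu> =o \<mu> ^c \<nu>'"
    using \<nu>'(1) assms(1,2) by (rule cexp_cong2)
  ultimately show ?thesis
    using ordIso_ordLeq_trans by blast
qed

text \<open>Otherwise \<open>\<mu>\<^sup>\<mu>\<close> would be one of the powers bounded by \<open>\<mu>\<close>, against Cantor's theorem.\<close>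

lemma cexp_less_eq_imp_ordLeq:
  assumes "Card_order \<mu>" "Card_order \<theta>" "ctwo \<le>o \<mu>" "cexp_less \<mu> \<theta> =o \<mu>"
  shows "\<theta> \<le>o \<mu>"
proof (rule ccontr)
  assume "\<not> \<theta> \<le>o \<mu>"
  then have "\<mu> <o \<theta>"
    using assms(1,2) not_ordLeq_iff_ordLess card_order_on_well_order_on by metis
  then have "\<mu> ^c \<mu> \<le>o \<mu>"
    using assms(1,4) cexp_ordLeq_cexp_less ordLeq_ordIso_trans by blast
  moreover have "\<mu> <o \<mu> ^c \<mu>"
    using ordLess_ctwo_cexp[OF assms(1)] cexp_mono1[OF assms(3,1)] by (rule ordLess_ordLeq_trans)
  ultimately show False
    using not_ordLess_ordLeq by blast
qed

lemma weight_cone_topology_cexp_less: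
  assumes \<mu>: "Cinfinite \<mu>" and \<theta>: "Cinfinite \<theta>" "\<theta> \<le>o \<mu>" and pow: "cexp_less \<mu> \<theta> =o \<mu>"
    and S: "S \<subseteq> Func (Field \<theta>) (Field \<mu>)"
  shows "weight (cone_topology \<theta> S) \<le>o \<mu>"
proof (rule weight_cone_topology[OF _ S \<mu>])
  show "Linear_order \<theta>"
    using \<theta>(1) by (simp add: card_order_on_def well_order_on_def)
  show "|Field \<theta>| \<le>o \<mu>"
    using \<theta> card_of_Field_ordIso ordIso_ordLeq_trans by blast
  show "|Func (under \<theta> \<alpha>) (Field \<mu>)| \<le>o \<mu>" if "\<alpha> \<in> Field \<theta>" for \<alpha>
  proof -
    have "\<mu> ^c |under \<theta> \<alpha>| \<le>o cexp_less \<mu> \<theta>"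
      using \<mu> card_of_under_ordLess[OF \<theta>(1) that]
      by (simp add: cexp_ordLeq_cexp_less card_of_Card_order)
    then have "\<mu> ^c |under \<theta> \<alpha>| \<le>o \<mu>"
      using pow by (rule ordLeq_ordIso_trans)
    then show ?thesis
      by (simp add: cexp_def Field_card_of)
  qed
qed

theorem theorem2p8:
  fixes \<kappa> :: "'k rel" and \<mu> :: "'m rel" and \<theta> :: "'t rel"
  assumes "Card_order \<kappa>" and "cardSuc natLeq \<le>o \<kappa>"
    and "Card_order \<mu>" and "Card_order \<theta>"
    and "cexp_less \<mu> \<theta> =o \<mu>" and "\<mu> <o \<kappa>" and "\<kappa> \<le>o \<mu> ^c \<theta>"
  shows "\<not> square_compact \<kappa>"
proof -
  have "cinfinite (\<mu> ^c \<theta>)"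
    using Cinfinite_cardSuc[OF natLeq_Cinfinite] cinfinite_mono ordLeq_transitive[OF assms(2,7)]
    by blast
  then have le: "\<theta> \<le>o \<mu>" and \<mu>: "Cinfinite \<mu>"
    using assms(3-5) cexp_less_eq_imp_ordLeq cinfinite_cexp_imp_ctwo_ordLeq
      cinfinite_cexp_imp_Cinfinite_base by blast+
  have \<theta>: "Cinfinite \<theta>"
    using \<mu> assms(4) ordLess_ordLeq_trans[OF assms(6,7)]
    by (rule ordLess_cexp_imp_Cinfinite_exponent)
  obtain S where S: "S \<subseteq> Func (Field \<theta>) (Field \<mu>)" "|S| =o \<kappa>"
    using assms(1,7) unfolding cexp_def by (rule subset_card_of_ordIsoE)
  have "Well_order \<theta>" "Field \<theta> \<noteq> {}" "Linear_order \<theta>" "Linear_order \<mu>"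
    using assms(3) \<theta> by (auto simp: card_order_on_def well_order_on_def cinfinite_def)
  then interpret weakly_ordered_space "cone_topology \<theta> S" "lex_order \<theta> \<mu> S"
    using S(1) by (intro weakly_ordered_space_cone_topology)
  have "topspace (cone_topology \<theta> S) = S"
    using \<open>Linear_order \<theta>\<close> \<open>Field \<theta> \<noteq> {}\<close> by (rule topspace_cone_topology)
  moreover have "weight (cone_topology \<theta> S) \<le>o \<mu>"
    using \<mu> \<theta> le assms(5) S(1) by (rule weight_cone_topology_cexp_less)
  ultimately show ?thesis
    using not_square_compact[OF \<mu> assms(6)] S(2) by simp
qed

end
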